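(* Let $J\in\{\mathbb{Z}^+,\mathbb{Z}^-\}$, let $X_1,X_2$ be Hilbert spaces, and let $A_{11}(n)\in\mathcal{L}(X_1)$, $A_{12}(n)\in\mathcal{L}(X_2,X_1)$, $A_{22}(n)\in\mathcal{L}(X_2)$ for $n\in J$. If the block diagonal system $$x(n+1)=\begin{pmatrix}A_{11}(n)&0\\0&A_{22}(n)\end{pmatrix}x(n),\quad n\in J',$$ on $X_1\times X_2$ admits an exponential dichotomy and $\sup_{n\in J}\|A_{12}(n)\|<+\infty$, then the block triangular system $$x(n+1)=\begin{pmatrix}A_{11}(n)&A_{12}(n)\\0&A_{22}(n)\end{pmatrix}x(n),\quad n\in J',$$ admits an exponential dichotomy.
   Context: $\mathbb{Z}^+$ is the set of nonnegative integers, $\mathbb{Z}^-$ the set of nonpositive integers; $J'=J$ if $J=\mathbb{Z}^+$ and $J'=\mathbb{Z}^-\setminus\{0\}$ if $J=\mathbb{Z}^-$. $\mathcal{L}(X,Y)$ denotes the bounded linear operators $X\to Y$, and $\mathcal{L}(X)=\mathcal{L}(X,X)$. $X_1\times X_2$ carries the norm $\|(x_1,x_2)\|=\max\{\|x_1\|,\|x_2\|\}$ (equivalent to its Hilbert norm). Exponential dichotomy. Let $X$ be a Banach space and $(A(n))_{n\in J}\subset\mathcal{L}(X)$. For $m,n\in J$, $m\ge n$, put $\Phi(m,n)=A(m-1)\cdots A(n)$ if $m>n$ and $\Phi(n,n)=\mathrm{Id}$. The system $x(n+1)=A(n)x(n)$, $n\in J'$, admits an exponential dichotomy if there exist (bounded)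 projections $(P(n))_{n\in J}\subset\mathcal{L}(X)$ and constants $K,\alpha>0$ such that: (i) for every $n\in J'$, $A(n)P(n)=P(n+1)A(n)$ and $A(n)|_{\mathcal{N}P(n)}:\mathcal{N}P(n)\to\mathcal{N}P(n+1)$ is invertible, where $\mathcal{N}P(n)$ is the kernel of $P(n)$; (ii) $\|\Phi(m,n)P(n)\|\le Ke^{-\alpha(m-n)}$ for $m,n\in J$, $m\ge n$; (iii) $\|\Phi(m,n)(\mathrm{Id}-P(n))\|\le Ke^{-\alpha(n-m)}$ for $m,n\in J$, $m\le n$, where for $m\le n$, $\Phi(m,n):=(\Phi(n,m)|_{\mathcal{N}P(m)})^{-1}:\mathcal{N}P(n)\to\mathcal{N}P(m)$. *)

theory Defs
  imports "HOL-Analysis.Analysis"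
begin

text \<open>
  Hilbert spaces are taken over an arbitrary scalar field \<open>'k :: real_normed_field\<close>, so that real
  spaces (\<open>'k = real\<close>, \<open>s = scaleR\<close>) and complex spaces (\<open>'k = complex\<close>) are treated at once; by the
  Gelfand--Mazur theorem there are no further cases up to isomorphism. A Banach space over \<open>'k\<close> is a
  real Banach type with a compatible scalar multiplication \<open>s\<close>. A complex Hilbert space is in the same
  way a complete \<open>real_inner\<close> type, carrying the real part of its inner product, with a compatible
  \<open>s\<close>: homogeneity of the norm makes multiplication by \<open>\<i>\<close> an isometry, and the complex inner product
  is \<open>x \<bullet> y + \<i> (x \<bullet> s \<i> y)\<close> (conjugate linear in \<open>y\<close>).
\<close>

locale normed_scaling = vector_space s
  for s :: "'k::real_normed_field \<Rightarrow> 'a::real_normed_vector \<Rightarrow> 'a" +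
  assumes norm_scaling: "norm (s c x) = norm c * norm x"
    and scaling_of_real: "s (of_real r) x = r *\<^sub>R x"

text \<open>The bounded operators that are linear over \<open>'k\<close>, for scalar multiplications \<open>s\<close> and \<open>t\<close>.\<close>

definition bounded_ops ::
    "('k::real_normed_field \<Rightarrow> 'a::real_normed_vector \<Rightarrow> 'a) \<Rightarrow>
     ('k \<Rightarrow> 'b::real_normed_vector \<Rightarrow> 'b) \<Rightarrow> ('a \<Rightarrow>\<^sub>L 'b) set" where
  "bounded_ops s t = {T. Vector_Spaces.linear s t (blinfun_apply T)}"

lemma normed_scaling_scaleR: "normed_scaling (scaleR :: real \<Rightarrow> 'a::real_normed_vector \<Rightarrow> 'a)"
  by unfold_locales (auto simp: algebra_simps)

definition nonneg_ints :: "int set" where "nonneg_ints = {n. 0 \<le> n}"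
definition nonpos_ints :: "int set" where "nonpos_ints = {n. n \<le> 0}"

text \<open>The set \<open>J'\<close> of times at which the recursion \<open>x (n + 1) = A n (x n)\<close> is imposed.\<close>

definition step_times :: "int set \<Rightarrow> int set" where
  "step_times J = (if J = nonpos_ints then nonpos_ints - {0} else J)"

primrec iterate_op :: "(int \<Rightarrow> 'a::real_normed_vector \<Rightarrow>\<^sub>L 'a) \<Rightarrow> int \<Rightarrow> nat \<Rightarrow> 'a \<Rightarrow>\<^sub>L 'a" where
  "iterate_op A n 0 = id_blinfun"
| "iterate_op A n (Suc k) = A (n + int k) o\<^sub>L iterate_op A n k"

text \<open>\<open>A (m - 1) \<circ> \<dots> \<circ> A n\<close>; only meaningful for \<open>n \<le> m\<close>.\<close>

definition transition :: "(int \<Rightarrow> 'a::real_normed_vector \<Rightarrow>\<^sub>L 'a) \<Rightarrow> int \<Rightarrow> int \<Rightarrow> 'a \<Rightarrow>\<^sub>L 'a" where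
  "transition A m n = iterate_op A n (nat (m - n))"

definition null_space :: "('a::real_normed_vector \<Rightarrow>\<^sub>L 'b::real_normed_vector) \<Rightarrow> 'a set" where
  "null_space T = {x. blinfun_apply T x = 0}"

text \<open>
  The backward evolution from time \<open>n\<close> to time \<open>m \<le> n\<close>: the inverse of the restriction of
  \<open>transition A n m\<close> to the kernel of \<open>P m\<close>. Only its values on the kernel of \<open>P n\<close> are meaningful.
\<close>

definition back_transition ::
    "(int \<Rightarrow> 'a::real_normed_vector \<Rightarrow>\<^sub>L 'a) \<Rightarrow> (int \<Rightarrow> 'a \<Rightarrow>\<^sub>L 'a) \<Rightarrow> int \<Rightarrow> int \<Rightarrow> 'a \<Rightarrow> 'a" where
  "back_transition A P m n = inv_into (null_space (P m)) (blinfun_apply (transition A n m))"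

text \<open>
  The last bound is the operator norm estimate for \<open>\<Phi>(m,n) (Id - P(n))\<close>, written pointwise because
  the inverse is not available as an element of the type of bounded operators.
\<close>

definition exponential_dichotomy ::
    "('k::real_normed_field \<Rightarrow> 'a::banach \<Rightarrow> 'a) \<Rightarrow> int set \<Rightarrow> (int \<Rightarrow> 'a \<Rightarrow>\<^sub>L 'a) \<Rightarrow> bool" where
  "exponential_dichotomy s J A \<longleftrightarrow>
    (\<exists>(P :: int \<Rightarrow> 'a \<Rightarrow>\<^sub>L 'a) (K :: real) (\<alpha> :: real).
       K > 0 \<and> \<alpha> > 0 \<and>
       (\<forall>n\<in>J. P n \<in> bounded_ops s s \<and> P n o\<^sub>L P n = P n) \<and>
       (\<forall>n\<in>step_times J.
          A n o\<^sub>L P n = P (n + 1) o\<^sub>L A n \<and>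
          bij_betw (blinfun_apply (A n)) (null_space (P n)) (null_space (P (n + 1)))) \<and>
       (\<forall>m\<in>J. \<forall>n\<in>J. n \<le> m \<longrightarrow>
          norm (transition A m n o\<^sub>L P n) \<le> K * exp (- \<alpha> * real_of_int (m - n))) \<and>
       (\<forall>m\<in>J. \<forall>n\<in>J. m \<le> n \<longrightarrow>
          (\<forall>x. norm (back_transition A P m n (x - blinfun_apply (P n) x))
                 \<le> K * exp (- \<alpha> * real_of_int (n - m)) * norm x)))"

text \<open>
  Block operators on the product type. Its library norm is the Hilbert norm, which is equivalent to
  the maximum norm; passing from one to the other only changes the constant \<open>K\<close> of a dichotomy.
\<close>

definition block_op ::
    "('a::real_normed_vector \<Rightarrow>\<^sub>L 'a) \<Rightarrow> ('b::real_normed_vector \<Rightarrow>\<^sub>L 'a) \<Rightarrow>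
     ('a \<Rightarrow>\<^sub>L 'b) \<Rightarrow> ('b \<Rightarrow>\<^sub>L 'b) \<Rightarrow> ('a \<times> 'b) \<Rightarrow>\<^sub>L ('a \<times> 'b)" where
  "block_op A B C D =
     Blinfun (\<lambda>x. (blinfun_apply A (fst x) + blinfun_apply B (snd x),
                   blinfun_apply C (fst x) + blinfun_apply D (snd x)))"

lemma block_op_apply [simp]:
  "blinfun_apply (block_op A B C D) (x, y) =
     (blinfun_apply A x + blinfun_apply B y, blinfun_apply C x + blinfun_apply D y)"
  unfolding block_op_def
  by (subst bounded_linear_Blinfun_apply) (auto intro!: bounded_linear_intros)

end

theory Submission
  imports Defs
begin

text \<open>
  Let \<open>E\<close> be the projection onto the first factor, \<open>A\<close> the diagonal and \<open>N = E N (Id - E)\<close> the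
  off-diagonal part. A dichotomy projection \<open>P\<close> of the diagonal system may be replaced by its
  block diagonal part, because the range (on the right half line) or the kernel (on the left one) of
  \<open>P\<close> is \<open>E\<close>-invariant. The equation \<open>W (n + 1) A n - A n W n = P' N (Id - P) + (Id - P') N P\<close>, with
  \<open>P' = P (n + 1)\<close> and \<open>N\<close>, \<open>P\<close> taken at \<open>n\<close>, has a bounded solution of the form
  \<open>W = E W (Id - E)\<close>, given by sums that converge since one factor of each term decays forwards and
  the other backwards. Conjugating \<open>A + N\<close> by \<open>Id + W\<close> yields a system commuting with \<open>P\<close> whose
  restrictions to the range and (inverted) to the kernel of \<open>P\<close> are perturbed by strictly triangular
  bounded operators. Products of these contain at most one perturbing factor, so they keep decaying
  exponentially, and no smallness of \<open>N\<close> is needed.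
\<close>

section \<open>Iterates of operators, intertwining and time reversal\<close>

lemma norm_blinfun_compose3_le:
  assumes "norm S \<le> a" "norm T \<le> b" "norm V \<le> c"
  shows "norm (S o\<^sub>L T o\<^sub>L V) \<le> a * b * c"
proof -
  have "norm (S o\<^sub>L T o\<^sub>L V) \<le> norm S * norm T * norm V"
    by (meson mult_right_mono norm_blinfun_compose norm_ge_zero order_trans)
  also have "\<dots> \<le> a * b * c"
    using assms order_trans[OF norm_ge_zero assms(1)] order_trans[OF norm_ge_zero assms(2)]
    by (intro mult_mono mult_nonneg_nonneg) auto
  finally show ?thesis .
qed

lemma blinfun_compose_assoc': "(A o\<^sub>L B) o\<^sub>L C = A o\<^sub>L (B o\<^sub>L C)"
  by (rule blinfun_eqI) simp

lemma iterate_op_Suc_right: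
  "iterate_op A n (Suc k) = iterate_op A (n + 1) k o\<^sub>L A n"
proof (induction k)
  case (Suc k)
  have "iterate_op A n (Suc (Suc k)) = A (n + int (Suc k)) o\<^sub>L (iterate_op A (n + 1) k o\<^sub>L A n)"
    by (simp only: iterate_op.simps(2)[of A n "Suc k"] Suc.IH)
  also have "\<dots> = iterate_op A (n + 1) (Suc k) o\<^sub>L A n"
    by (simp add: blinfun_compose_assoc' algebra_simps)
  finally show ?case .
qed (simp add: blinfun_eqI)

lemma iterate_op_cong:
  assumes "\<And>i. i < k \<Longrightarrow> A (n + int i) = A' (n + int i)"
  shows "iterate_op A n k = iterate_op A' n k"
  using assms
proof (induction k)
  case (Suc k)
  then show ?case by (metis iterate_op.simps(2) lessI less_SucI)
qed simp

lemma iterate_op_commute: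
  fixes A :: "int \<Rightarrow> 'a::real_normed_vector \<Rightarrow>\<^sub>L 'a" and U :: "'a \<Rightarrow>\<^sub>L 'a"
  assumes "\<And>i x. U (A i x) = A i (U x)"
  shows "U (iterate_op A n k x) = iterate_op A n k (U x)"
  using assms by (induction k) simp_all

text \<open>One notion for two uses: with the same scalar multiplication as \<open>U\<close> and
  \<open>V\<close> it expresses linearity over the scalar field, with block projections it expresses
  which blocks of \<open>T n\<close> vanish.\<close>

definition intertwines ::
    "('a::real_normed_vector \<Rightarrow>\<^sub>L 'a) \<Rightarrow> ('a \<Rightarrow>\<^sub>L 'a) \<Rightarrow> (int \<Rightarrow> 'a \<Rightarrow>\<^sub>L 'a) \<Rightarrow> bool" where
  "intertwines U V T \<longleftrightarrow> (\<forall>n x. U (T n x) = T n (V x))"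

lemma intertwinesD: "intertwines U V T \<Longrightarrow> U (T n x) = T n (V x)"
  by (simp add: intertwines_def)

text \<open>An operator with index \<open>n\<close> acts between times \<open>n\<close> and
  \<open>n + 1\<close>. Reflection at the origin moves this pair to \<open>- n - 1\<close> and
  \<open>- n\<close>, whence the shift by one.\<close>

definition time_reversal :: "(int \<Rightarrow> 'a) \<Rightarrow> int \<Rightarrow> 'a" where
  "time_reversal A i = A (- i - 1)"

lemma time_reversal_involution [simp]: "time_reversal (time_reversal A) = A"
  by (rule ext) (simp add: time_reversal_def)

section \<open>Bounded solutions of operator recursions and nilpotent perturbations\<close>

text \<open>
  The solution is the sum over \<open>j\<close> of the contributions of the inhomogeneity at time \<open>n - j - 1\<close>.
  The commutation clause is applied with \<open>U\<close>, \<open>V\<close> scalar multiplications or block projections.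
\<close>

lemma ex_bounded_sylvester_solution:
  fixes L R F :: "int \<Rightarrow> 'a::banach \<Rightarrow>\<^sub>L 'a"
  assumes L: "\<And>n j. norm (iterate_op L n j) \<le> K * exp (- \<alpha> * real j)"
    and R: "\<And>n j. norm (iterate_op (time_reversal R) n j) \<le> K * exp (- \<alpha> * real j)"
    and F: "\<And>n. norm (F n) \<le> M"
    and \<alpha>: "\<alpha> > 0" and M: "M \<ge> 0"
  obtains Z :: "int \<Rightarrow> 'a \<Rightarrow>\<^sub>L 'a" and c where "\<And>n. norm (Z n) \<le> c"
    and "\<And>n x. Z (n + 1) x = L n (Z n (R n x)) + F n x"
    and "\<forall>U V. intertwines U U L \<and> intertwines V V R \<and> intertwines U V F \<longrightarrow> intertwines U V Z"
proof -
  have K: "K \<ge> 0"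
    using order_trans[OF norm_ge_zero L[of 0 0]] by simp
  \<comment> \<open>As a product, \<open>t n j\<close> is L(n-1) ... L(n-j) F(n-j-1) R(n-j) ...
    R(n-1); time reversal puts the factors of \<open>R\<close> in this order.\<close>
  define t where "t n j = iterate_op L (n - int j) j o\<^sub>L F (n - int j - 1)
    o\<^sub>L iterate_op (time_reversal R) (- n) j" for n j
  \<comment> \<open>One of the two exponential factors bounding \<open>t n j\<close> suffices for a
    summable majorant uniform in \<open>n\<close>; the other is estimated by 1.\<close>
  define b where "b j = K * M * K * exp (- \<alpha>) ^ j" for j :: nat
  have b: "summable b"
    unfolding b_def using \<alpha> by (intro summable_mult summable_geometric) simp
  have tb: "norm (t n j) \<le> b j" for n j
  proof -
    have "norm (t n j) \<le> (K * exp (- \<alpha> * real j)) * M * (K * exp (- \<alpha> * real j))"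
      unfolding t_def by (intro norm_blinfun_compose3_le L R F)
    also have "\<dots> \<le> (K * exp (- \<alpha> * real j)) * M * (K * 1)"
      using K M \<alpha> by (intro mult_left_mono mult_nonneg_nonneg) auto
    also have "\<dots> = b j"
      by (simp add: b_def exp_of_nat_mult[symmetric] mult.commute mult.left_commute)
    finally show ?thesis .
  qed
  have sn: "summable (\<lambda>j. norm (t n j))" for n
    using b tb by (intro summable_comparison_test'[OF b, of 0]) auto
  then have st: "summable (t n)" for n
    using summable_norm_cancel by blast
  define Z where "Z n = suminf (t n)" for n
  have Zx: "Z n x = (\<Sum>j. t n j x)" and sx: "summable (\<lambda>j. t n j x)" for n x
    using bounded_linear.suminf[OF blinfun.bounded_linear_left st]
      bounded_linear.summable[OF blinfun.bounded_linear_left st] by (auto simp: Z_def)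
  have Z1: "norm (Z n) \<le> suminf b" for n
    unfolding Z_def using summable_norm[OF sn] suminf_le[OF tb sn b] by (rule order_trans)
  have Z2: "Z (n + 1) x = L n (Z n (R n x)) + F n x" for n x
  proof -
    \<comment> \<open>Passing from \<open>n\<close> to \<open>n + 1\<close> multiplies each old term
      by \<open>L n\<close> on the left and by \<open>R n\<close> on the right; the new term, at
      index 0, is \<open>F n\<close>.\<close>
    have "t (n + 1) (Suc j) x = L n (t n j (R n x))" for j
      using iterate_op_Suc_right[of "time_reversal R" "-1 - n" j]
      by (simp add: t_def time_reversal_def algebra_simps)
    then have "(\<Sum>j. t (n + 1) (Suc j) x) = L n (Z n (R n x))"
      by (simp add: Zx bounded_linear.suminf[OF blinfun.bounded_linear_right sx])
    moreover have "t (n + 1) 0 x = F n x"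
      by (simp add: t_def)
    ultimately show ?thesis
      using suminf_split_head[OF sx, of "n + 1" x] by (simp add: Zx algebra_simps)
  qed
  have Z3: "intertwines U V Z"
    if "intertwines U U L" "intertwines V V R" "intertwines U V F" for U V
    unfolding intertwines_def
  proof (intro allI)
    fix n x
    have "V (time_reversal R i y) = time_reversal R i (V y)" for i y
      using intertwinesD[OF that(2)] by (simp add: time_reversal_def)
    then have "U (t n j x) = t n j (V x)" for j
      using intertwinesD[OF that(1)] intertwinesD[OF that(3)]
      by (simp add: t_def iterate_op_commute)
    then show "U (Z n x) = Z n (V x)"
      by (simp add: Zx bounded_linear.suminf[OF blinfun.bounded_linear_right sx])
  qed
  show ?thesis
    by (rule that[of Z "suminf b"]) (use Z1 Z2 Z3 in auto)
qed

text \<open>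
  Since \<open>Y\<close> is nilpotent, the evolution of \<open>X + Y\<close> differs from that of \<open>X\<close> by a single sum
  \<open>V n j\<close>, whose terms all decay like \<open>exp (- \<alpha> j)\<close>; halving the exponent absorbs their number.
\<close>

lemma nilpotent_perturbation_decay:
  fixes X Y :: "int \<Rightarrow> 'a::real_normed_vector \<Rightarrow>\<^sub>L 'a" and E :: "'a \<Rightarrow>\<^sub>L 'a"
  assumes X: "\<And>n j. norm (iterate_op X n j) \<le> K * exp (- \<alpha> * real j)"
    and Y: "\<And>n. norm (Y n) \<le> M"
    and EX: "\<And>n x. E (X n x) = X n (E x)"
    and EY: "\<And>n x. E (Y n x) = Y n x" and YE: "\<And>n x. Y n (E x) = 0"
    and \<alpha>: "\<alpha> > 0" and M: "M \<ge> 0"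
  shows "norm (iterate_op (\<lambda>i. X i + Y i) n j)
    \<le> (K + K * K * M * exp \<alpha> * 2 / \<alpha>) * exp (- (\<alpha> / 2) * real j)"
proof -
  have K: "K \<ge> 0"
    using order_trans[OF norm_ge_zero X[of 0 0]] by simp
  define V where "V j = iterate_op (\<lambda>i. X i + Y i) n j - iterate_op X n j" for j
  \<comment> \<open>The values of \<open>V j\<close> lie in the range of \<open>E\<close>, which
    every \<open>Y i\<close> annihilates. Hence no second perturbing factor survives in the
    recursion for \<open>V\<close>.\<close>
  have EV: "E (V j x) = V j x" for j x
  proof (induction j)
    case (Suc j)
    have "V (Suc j) x = X (n + int j) (V j x) + Y (n + int j) (iterate_op (\<lambda>i. X i + Y i) n j x)"
      by (simp add: V_def blinfun.bilinear_simps)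
    with Suc show ?case
      by (simp add: blinfun.add_right EX EY)
  qed (simp add: V_def blinfun.bilinear_simps)
  have "Y i (V j x) = 0" for i j x
    using YE[of i "V j x"] EV by simp
  then have V_Suc: "V (Suc j) x = X (n + int j) (V j x) + Y (n + int j) (iterate_op X n j x)" for j x
    by (simp add: V_def blinfun.bilinear_simps)
  \<comment> \<open>The \<open>k\<close> further steps of \<open>X\<close> strengthen the induction:
    each step adds one term with two unbroken evolutions of \<open>X\<close>, so powers of
    \<open>K\<close> do not build up. The factor \<open>exp \<alpha>\<close> pays for the one step
    spent in \<open>Y\<close>.\<close>
  have bound: "norm (iterate_op X (n + int j) k o\<^sub>L V j)
      \<le> real j * (K * K * M * exp \<alpha>) * exp (- \<alpha> * real (j + k))" for j k
  proof (induction j arbitrary: k)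
    case 0
    then show ?case by (simp add: V_def)
  next
    case (Suc j)
    have eq: "iterate_op X (n + int (Suc j)) k o\<^sub>L V (Suc j) =
        (iterate_op X (n + int j) (Suc k) o\<^sub>L V j) +
        (iterate_op X (n + int (Suc j)) k o\<^sub>L Y (n + int j) o\<^sub>L iterate_op X n j)"
      unfolding iterate_op_Suc_right
      by (rule blinfun_eqI) (simp add: V_Suc blinfun.bilinear_simps algebra_simps)
    have "norm (iterate_op X (n + int (Suc j)) k o\<^sub>L Y (n + int j) o\<^sub>L iterate_op X n j)
        \<le> (K * exp (- \<alpha> * real k)) * M * (K * exp (- \<alpha> * real j))"
      by (intro norm_blinfun_compose3_le X Y)
    also have "\<dots> = (K * K * M * exp \<alpha>) * exp (- \<alpha> * real (Suc j + k))"
      by (simp add: exp_add[symmetric] algebra_simps)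
    finally show ?case
      unfolding eq using Suc.IH[of "Suc k"]
      by (intro order_trans[OF norm_triangle_ineq]) (simp add: algebra_simps)
  qed
  have "norm (iterate_op (\<lambda>i. X i + Y i) n j) = norm (iterate_op X n j + V j)"
    by (simp add: V_def)
  also have "\<dots> \<le> K * exp (- \<alpha> * real j) + real j * (K * K * M * exp \<alpha>) * exp (- \<alpha> * real j)"
  proof (intro order_trans[OF norm_triangle_ineq] add_mono X)
    have "iterate_op X (n + int j) 0 o\<^sub>L V j = V j"
      by (rule blinfun_eqI) simp
    then show "norm (V j) \<le> real j * (K * K * M * exp \<alpha>) * exp (- \<alpha> * real j)"
      using bound[of j 0] by simp
  qed
  also have "\<dots> \<le> K * exp (- (\<alpha> / 2) * real j)
      + (K * K * M * exp \<alpha> * 2 / \<alpha>) * exp (- (\<alpha> / 2) * real j)"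
  proof (rule add_mono)
    show "K * exp (- \<alpha> * real j) \<le> K * exp (- (\<alpha> / 2) * real j)"
      using K \<alpha> by (intro mult_left_mono) auto
    have "real j * \<alpha> / 2 \<le> exp (real j * \<alpha> / 2)"
      using exp_ge_add_one_self[of "real j * \<alpha> / 2"] by linarith
    then have "real j \<le> 2 / \<alpha> * exp (real j * \<alpha> / 2)"
      using \<alpha> by (simp add: field_simps)
    then have "real j * exp (- \<alpha> * real j) \<le> 2 / \<alpha> * exp (real j * \<alpha> / 2) * exp (- \<alpha> * real j)"
      by (intro mult_right_mono) auto
    also have "\<dots> = 2 / \<alpha> * exp (- (\<alpha> / 2) * real j)"
      by (simp add: exp_add[symmetric] algebra_simps)
    finally have "(K * K * M * exp \<alpha>) * (real j * exp (- \<alpha> * real j))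
        \<le> (K * K * M * exp \<alpha>) * (2 / \<alpha> * exp (- (\<alpha> / 2) * real j))"
      using K M by (intro mult_left_mono) auto
    then show "real j * (K * K * M * exp \<alpha>) * exp (- \<alpha> * real j)
        \<le> K * K * M * exp \<alpha> * 2 / \<alpha> * exp (- (\<alpha> / 2) * real j)"
      by (simp add: algebra_simps)
  qed
  also have "\<dots> = (K + K * K * M * exp \<alpha> * 2 / \<alpha>) * exp (- (\<alpha> / 2) * real j)"
    by (simp add: distrib_right)
  finally show ?thesis .
qed

section \<open>Dichotomies with bounded operators as backward evolution\<close>

text \<open>
  The operator \<open>G n j\<close> is the backward evolution from time \<open>n + j\<close> to time \<open>n\<close>, preceded by the
  projection \<open>Id - P (n + j)\<close>.
\<close>

locale dichotomy_data =
  fixes J :: "int set" and A P :: "int \<Rightarrow> 'a::banach \<Rightarrow>\<^sub>L 'a" and G :: "int \<Rightarrow> nat \<Rightarrow> 'a \<Rightarrow>\<^sub>L 'a"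
    and K \<alpha> :: real
  assumes K_pos: "K > 0" and \<alpha>_pos: "\<alpha> > 0"
    and interval: "\<And>a b c. \<lbrakk>a \<in> J; c \<in> J; a \<le> b; b \<le> c\<rbrakk> \<Longrightarrow> b \<in> J"
    and P_idem: "\<And>n x. n \<in> J \<Longrightarrow> P n (P n x) = P n x"
    and A_P: "\<And>n x. \<lbrakk>n \<in> J; n + 1 \<in> J\<rbrakk> \<Longrightarrow> A n (P n x) = P (n + 1) (A n x)"
    and G_iterate: "\<And>n j x. \<lbrakk>n \<in> J; n + int j \<in> J\<rbrakk> \<Longrightarrow> G n j (iterate_op A n j x) = x - P n x"
    and iterate_G: "\<And>n j x. \<lbrakk>n \<in> J; n + int j \<in> J\<rbrakk> \<Longrightarrow> iterate_op A n j (G n j x) = x - P (n + int j) x"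
    and P_G: "\<And>n j x. \<lbrakk>n \<in> J; n + int j \<in> J\<rbrakk> \<Longrightarrow> P n (G n j x) = 0"
    and forward_bound: "\<And>n j. \<lbrakk>n \<in> J; n + int j \<in> J\<rbrakk> \<Longrightarrow>
      norm (iterate_op A n j o\<^sub>L P n) \<le> K * exp (- \<alpha> * real j)"
    and G_bound: "\<And>n j. \<lbrakk>n \<in> J; n + int j \<in> J\<rbrakk> \<Longrightarrow> norm (G n j) \<le> K * exp (- \<alpha> * real j)"
begin

lemma iterate_P:
  assumes "n \<in> J" "n + int j \<in> J"
  shows "iterate_op A n j (P n x) = P (n + int j) (iterate_op A n j x)"
  using assms(2)
proof (induction j)
  case (Suc j)
  have "n + int j \<in> J"
    by (rule interval[OF assms(1) Suc.prems]) auto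
  with Suc show ?case
    using A_P[of "n + int j"] by (simp add: algebra_simps)
qed simp

text \<open>Compute \<open>G n j (iterate_op A n j (G n j x))\<close> in two ways.\<close>

lemma G_P:
  assumes "n \<in> J" "n + int j \<in> J"
  shows "G n j (P (n + int j) x) = 0"
proof -
  have "G n j x = G n j (iterate_op A n j (G n j x))"
    using assms by (simp add: G_iterate P_G)
  also have "\<dots> = G n j x - G n j (P (n + int j) x)"
    using assms by (simp add: iterate_G blinfun.diff_right)
  finally show ?thesis by simp
qed

lemma P_bound: "n \<in> J \<Longrightarrow> norm (P n) \<le> K"
proof -
  assume "n \<in> J"
  moreover have "iterate_op A n 0 o\<^sub>L P n = P n"
    by (rule blinfun_eqI) simp
  ultimately show ?thesis
    using forward_bound[of n 0] by simp
qed

text \<open>Serves to identify products of one-step backward operators with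
  \<open>G\<close>.\<close>

lemma G_unique:
  assumes "n \<in> J" "n + int j \<in> J"
    and "\<And>x. iterate_op A n j (f x) = x - P (n + int j) x" and "\<And>x. P n (f x) = 0"
  shows "f x = G n j x"
proof -
  have "f x = G n j (iterate_op A n j (f x))"
    by (simp add: G_iterate[OF assms(1,2)] assms(4))
  also have "\<dots> = G n j x"
    by (simp add: assms(3) G_P[OF assms(1,2)] blinfun.diff_right)
  finally show ?thesis .
qed

end

text \<open>In this form the step times treat both half lines alike; later only
  \<open>range_or_kernel_invariant\<close> distinguishes them.\<close>

lemma step_times_iff:
  assumes "J = nonneg_ints \<or> J = nonpos_ints"
  shows "n \<in> step_times J \<longleftrightarrow> n \<in> J \<and> n + 1 \<in> J"
proof -
  have "(- 1 :: int) \<in> nonpos_ints" "(- 1 :: int) \<notin> nonneg_ints"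
    by (auto simp: nonneg_ints_def nonpos_ints_def)
  then have "nonneg_ints \<noteq> nonpos_ints" by metis
  with assms show ?thesis
    by (auto simp: step_times_def) (auto simp: nonneg_ints_def nonpos_ints_def)
qed

lemma half_line_interval:
  assumes "J = nonneg_ints \<or> J = nonpos_ints"
  shows "\<lbrakk>a \<in> J; c \<in> J; a \<le> b; b \<le> c\<rbrakk> \<Longrightarrow> b \<in> J"
  using assms by (auto simp: nonneg_ints_def nonpos_ints_def)

lemma null_space_diff_idem:
  assumes "P o\<^sub>L P = P"
  shows "x - blinfun_apply P x \<in> null_space P"
  using assms by (simp add: null_space_def blinfun.diff_right) (metis blinfun_apply_blinfun_compose)

text \<open>The set-theoretic inverse on the kernel, preceded by Id - P, is linear because the
  evolution is injective there, and bounded by the dichotomy estimate. So it is a bounded operator,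
  which serves as \<open>G\<close>.\<close>

lemma exponential_dichotomy_imp_dichotomy_data:
  fixes A :: "int \<Rightarrow> 'a::banach \<Rightarrow>\<^sub>L 'a"
  assumes J: "J = nonneg_ints \<or> J = nonpos_ints" and ed: "exponential_dichotomy s J A"
  obtains P G K \<alpha> where "dichotomy_data J A P G K \<alpha>" "\<And>n. n \<in> J \<Longrightarrow> P n \<in> bounded_ops s s"
proof -
  obtain P :: "int \<Rightarrow> 'a \<Rightarrow>\<^sub>L 'a" and K \<alpha> where pos: "K > 0" "\<alpha> > 0"
    and P: "\<And>n. n \<in> J \<Longrightarrow> P n \<in> bounded_ops s s" "\<And>n. n \<in> J \<Longrightarrow> P n o\<^sub>L P n = P n"
    and AP: "\<And>n. n \<in> step_times J \<Longrightarrow> A n o\<^sub>L P n = P (n + 1) o\<^sub>L A n"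
    and bij: "\<And>n. n \<in> step_times J \<Longrightarrow>
      bij_betw (blinfun_apply (A n)) (null_space (P n)) (null_space (P (n + 1)))"
    and fwd: "\<And>m n. \<lbrakk>m \<in> J; n \<in> J; n \<le> m\<rbrakk> \<Longrightarrow>
      norm (transition A m n o\<^sub>L P n) \<le> K * exp (- \<alpha> * real_of_int (m - n))"
    and bwd: "\<And>m n x. \<lbrakk>m \<in> J; n \<in> J; m \<le> n\<rbrakk> \<Longrightarrow>
      norm (back_transition A P m n (x - blinfun_apply (P n) x))
        \<le> K * exp (- \<alpha> * real_of_int (n - m)) * norm x"
    using ed unfolding exponential_dichotomy_def
  proof (elim exE conjE, goal_cases)
    case (1 P K \<alpha>)
    show ?case
      by (rule 1(1)[of K \<alpha> P]) (use 1(2-) in blast)+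
  qed
  note interval = half_line_interval[OF J]
  have bijs: "bij_betw (blinfun_apply (iterate_op A n j)) (null_space (P n)) (null_space (P (n + int j)))"
    if "n \<in> J" "n + int j \<in> J" for n j
    using that(2)
  proof (induction j)
    case 0
    have "blinfun_apply (iterate_op A n 0) = id" by auto
    then show ?case by simp
  next
    case (Suc j)
    have "n + int j \<in> J"
      by (rule interval[OF that(1) Suc.prems]) auto
    then have "bij_betw (blinfun_apply (A (n + int j)) \<circ> blinfun_apply (iterate_op A n j))
        (null_space (P n)) (null_space (P (n + int j + 1)))"
      using Suc.prems by (intro bij_betw_trans[OF Suc.IH] bij) (auto simp: step_times_iff[OF J] algebra_simps)
    then show ?case
      by (simp add: o_def algebra_simps)
  qed
  define g where "g n j x = back_transition A P n (n + int j) (x - P (n + int j) x)" for n j x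
  have g_null: "P n (g n j x) = 0" and g_right: "iterate_op A n j (g n j x) = x - P (n + int j) x"
    if "n \<in> J" "n + int j \<in> J" for n j x
  proof -
    have "x - P (n + int j) x \<in> blinfun_apply (iterate_op A n j) ` null_space (P n)"
      using null_space_diff_idem[OF P(2)[OF that(2)], of x] bij_betw_imp_surj_on[OF bijs[OF that]]
      by simp
    from inv_into_into[OF this] f_inv_into_f[OF this]
    show "P n (g n j x) = 0" "iterate_op A n j (g n j x) = x - P (n + int j) x"
      by (simp_all add: g_def back_transition_def transition_def null_space_def)
  qed
  \<comment> \<open>Injectivity on the kernel of \<open>P n\<close>; additivity, homogeneity and the
    left inverse property of \<open>g n j\<close> all reduce to this.\<close>
  have g_unique: "y = g n j x"
    if "n \<in> J" "n + int j \<in> J" "P n y = 0" "iterate_op A n j y = x - P (n + int j) x" for n j x y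
    using bijs[OF that(1,2)] g_null[OF that(1,2), of x] g_right[OF that(1,2), of x] that(3,4)
    by (auto simp: bij_betw_def inj_on_def null_space_def)
  have g_lin: "bounded_linear (g n j)" and g_bound: "norm (g n j x) \<le> K * exp (- \<alpha> * real j) * norm x"
    if "n \<in> J" "n + int j \<in> J" for n j x
  proof -
    show bound: "norm (g n j x) \<le> K * exp (- \<alpha> * real j) * norm x" for x
      using bwd[OF that, of x] by (simp add: g_def)
    show "bounded_linear (g n j)"
    proof (rule bounded_linear_intro)
      show "g n j (x + y) = g n j x + g n j y" for x y
        by (rule g_unique[OF that, symmetric])
          (simp_all add: blinfun.add_right g_null[OF that] g_right[OF that])
      show "g n j (c *\<^sub>R x) = c *\<^sub>R g n j x" for c x
        by (rule g_unique[OF that, symmetric])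
          (simp_all add: blinfun.scaleR_right g_null[OF that] g_right[OF that] algebra_simps)
      show "norm (g n j x) \<le> norm x * (K * exp (- \<alpha> * real j))" for x
        using bound[of x] by (simp add: mult.commute)
    qed
  qed
  have "dichotomy_data J A P (\<lambda>n j. Blinfun (g n j)) K \<alpha>"
  proof (unfold_locales)
    show idem: "P n (P n x) = P n x" if "n \<in> J" for n x
      using P(2)[OF that] by (metis blinfun_apply_blinfun_compose)
    show comm: "A n (P n x) = P (n + 1) (A n x)" if "n \<in> J" "n + 1 \<in> J" for n x
      using AP[of n] that step_times_iff[OF J] by (metis blinfun_apply_blinfun_compose)
    fix n j assume nj: "n \<in> J" "n + int j \<in> J"
    note [simp] = bounded_linear_Blinfun_apply[OF g_lin[OF nj]]
    show "iterate_op A n j (Blinfun (g n j) x) = x - P (n + int j) x" "P n (Blinfun (g n j) x) = 0" for x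
      by (simp_all add: g_right g_null nj)
    have "iterate_op A n j (P n x) = P (n + int j) (iterate_op A n j x)" for x
      using nj(2)
    proof (induction j)
      case (Suc j)
      have "n + int j \<in> J"
        by (rule interval[OF nj(1) Suc.prems]) auto
      with Suc show ?case
        using comm[of "n + int j"] by (simp add: algebra_simps)
    qed simp
    then show "Blinfun (g n j) (iterate_op A n j x) = x - P n x" for x
      by simp (intro g_unique[symmetric] nj; simp add: blinfun.diff_right idem nj)
    show "norm (iterate_op A n j o\<^sub>L P n) \<le> K * exp (- \<alpha> * real j)"
      using fwd[OF nj(2,1)] by (simp add: transition_def)
    show "norm (Blinfun (g n j)) \<le> K * exp (- \<alpha> * real j)"
      using pos g_bound[OF nj] by (intro norm_blinfun_bound) auto
  qed (fact pos interval)+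
  then show ?thesis by (rule that) (rule P(1))
qed

text \<open>The operator \<open>G n 1\<close> witnesses the invertibility of a single step, and
  \<open>G m j x\<close> is the unique preimage in the kernel that \<open>back_transition\<close>
  selects.\<close>

lemma (in dichotomy_data) imp_exponential_dichotomy:
  assumes J: "J = nonneg_ints \<or> J = nonpos_ints" and P: "\<And>n. n \<in> J \<Longrightarrow> P n \<in> bounded_ops s s"
  shows "exponential_dichotomy s J A"
  unfolding exponential_dichotomy_def
proof (intro exI conjI ballI impI allI)
  show "K > 0" "\<alpha> > 0" by (fact K_pos, fact \<alpha>_pos)
  fix n assume n: "n \<in> J"
  show "P n \<in> bounded_ops s s" using P n .
  show "P n o\<^sub>L P n = P n" using P_idem[OF n] by (intro blinfun_eqI) simp
next
  fix n assume "n \<in> step_times J"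
  then have n: "n \<in> J" "n + 1 \<in> J" using step_times_iff[OF J] by auto
  show "A n o\<^sub>L P n = P (n + 1) o\<^sub>L A n"
    using A_P[OF n] by (intro blinfun_eqI) simp
  show "bij_betw (blinfun_apply (A n)) (null_space (P n)) (null_space (P (n + 1)))"
    using G_iterate[of n 1] iterate_G[of n 1] P_G[of n 1] n A_P[OF n]
    by (intro bij_betw_byWitness[where f' = "blinfun_apply (G n 1)"])
      (auto simp: null_space_def simp flip: A_P[OF n])
next
  fix m n assume mn: "m \<in> J" "n \<in> J" "n \<le> m"
  then show "norm (transition A m n o\<^sub>L P n) \<le> K * exp (- \<alpha> * real_of_int (m - n))"
    using forward_bound[of n "nat (m - n)"] by (simp add: transition_def)
next
  fix m n x assume mn: "m \<in> J" "n \<in> J" "m \<le> n"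
  define j where "j = nat (n - m)"
  have n: "n = m + int j" using mn by (simp add: j_def)
  have "inj_on (blinfun_apply (iterate_op A m j)) (null_space (P m))"
    using G_iterate[of m j] mn n
    by (intro inj_on_inverseI[where g = "blinfun_apply (G m j)"]) (auto simp: null_space_def)
  then have "back_transition A P m n (x - P n x) = G m j x"
    using P_G[of m j] iterate_G[of m j] mn n unfolding back_transition_def
    by (intro inv_into_f_eq) (auto simp: null_space_def transition_def)
  moreover have "norm (G m j x) \<le> K * exp (- \<alpha> * real j) * norm x"
    using G_bound[of m j] mn n
    by (meson mult_right_mono norm_blinfun norm_ge_zero order_trans)
  ultimately show "norm (back_transition A P m n (x - P n x))
      \<le> K * exp (- \<alpha> * real_of_int (n - m)) * norm x"
    using n by simp
qed

section \<open>Passage to block diagonal projections\<close>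

lemma decay_imp_zero:
  fixes v :: "'a::real_normed_vector"
  assumes "\<And>j. norm v \<le> C * exp (- \<alpha> * real j)" "\<alpha> > 0"
  shows "v = 0"
proof -
  have "(\<lambda>j. C * exp (- \<alpha>) ^ j) \<longlonglongrightarrow> C * 0"
    using assms(2) by (intro tendsto_mult tendsto_const LIMSEQ_power_zero) simp
  then have "(\<lambda>j. C * exp (- \<alpha> * real j)) \<longlonglongrightarrow> 0"
    by (simp add: exp_of_nat_mult[symmetric] mult.commute)
  then have "norm v \<le> 0"
    by (rule tendsto_lowerbound) (use assms(1) in auto)
  then show ?thesis by simp
qed

definition block_diagonal_part :: "('a::real_normed_vector \<Rightarrow>\<^sub>L 'a) \<Rightarrow> ('a \<Rightarrow>\<^sub>L 'a) \<Rightarrow> 'a \<Rightarrow>\<^sub>L 'a" where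
  "block_diagonal_part E T = (E o\<^sub>L T o\<^sub>L E) + ((id_blinfun - E) o\<^sub>L T o\<^sub>L (id_blinfun - E))"

lemma block_diagonal_part_apply:
  "block_diagonal_part E T x = E (T (E x)) + (T (x - E x) - E (T (x - E x)))"
  by (simp add: block_diagonal_part_def blinfun.bilinear_simps)

lemma norm_block_diagonal_part:
  "norm (block_diagonal_part E T) \<le> ((norm E)\<^sup>2 + (norm (id_blinfun - E))\<^sup>2) * norm T"
proof -
  have *: "norm (S o\<^sub>L T o\<^sub>L S) \<le> (norm S)\<^sup>2 * norm T" for S :: "'a \<Rightarrow>\<^sub>L 'a"
    using norm_blinfun_compose3_le[of S _ T _ S, OF order_refl order_refl order_refl]
    by (simp add: power2_eq_square algebra_simps)
  show ?thesis
    unfolding block_diagonal_part_def distrib_right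
    by (intro order_trans[OF norm_triangle_ineq] add_mono *)
qed

text \<open>
  On a right (left) half line the range (kernel) of \<open>P n\<close> is determined by \<open>A\<close> alone, hence invariant
  under every \<open>E\<close> commuting with \<open>A\<close>. This makes the diagonal part of \<open>P n\<close> a projection, although
  \<open>P n\<close> itself need not be block diagonal.
\<close>

lemma (in dichotomy_data) range_or_kernel_invariant:
  fixes E :: "'a \<Rightarrow>\<^sub>L 'a"
  assumes J: "J = nonneg_ints \<or> J = nonpos_ints"
    and E_A: "\<And>n x. E (A n x) = A n (E x)"
  shows "(\<forall>n\<in>J. \<forall>x. P n (E (P n x)) = E (P n x)) \<or> (\<forall>n\<in>J. \<forall>x. P n (E (P n x)) = P n (E x))"
  using J
proof
  have e: "exp (- \<alpha> * real j) \<le> 1" for j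
    using \<alpha>_pos by simp
  assume J: "J = nonneg_ints"
  have "P n (E (P n x)) = E (P n x)" if n: "n \<in> J" for n x
  proof -
    \<comment> \<open>This is the component of \<open>E (P n x)\<close> in the kernel of
      \<open>P n\<close>. Going \<open>j\<close> steps ahead on the range and back through
      \<open>G n j\<close> yields a decaying factor, and \<open>j\<close> is unbounded on the right
      half line.\<close>
    have "norm (E (P n x) - P n (E (P n x))) \<le> (K * norm E * K * norm x) * exp (- \<alpha> * real j)" for j
    proof -
      have nj: "n + int j \<in> J" using n J by (auto simp: nonneg_ints_def)
      have "E (P n x) - P n (E (P n x)) = (G n j o\<^sub>L E o\<^sub>L (iterate_op A n j o\<^sub>L P n)) x"
        using iterate_op_commute[of E A n j, OF E_A] G_iterate[OF n nj, of "E (P n x)"] by simp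
      also have "norm \<dots> \<le> norm (G n j o\<^sub>L E o\<^sub>L (iterate_op A n j o\<^sub>L P n)) * norm x"
        by (rule norm_blinfun)
      also have "\<dots> \<le> K * norm E * (K * exp (- \<alpha> * real j)) * norm x"
        using K_pos e[of j]
        by (intro mult_right_mono norm_blinfun_compose3_le order_trans[OF G_bound[OF n nj]]
            forward_bound[OF n nj]) auto
      finally show ?thesis by (simp add: algebra_simps)
    qed
    then have "E (P n x) - P n (E (P n x)) = 0"
      using \<alpha>_pos by (rule decay_imp_zero)
    then show ?thesis by simp
  qed
  then show ?thesis by blast
next
  have e: "exp (- \<alpha> * real j) \<le> 1" for j
    using \<alpha>_pos by simp
  assume J: "J = nonpos_ints"
  have "P n (E (P n x)) = P n (E x)" if n: "n \<in> J" for n x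
  proof -
    \<comment> \<open>Past and future are exchanged: \<open>G m j\<close> leads back to time
      \<open>m\<close>, arbitrarily remote on the left half line, and the forward evolution on the
      range returns to \<open>n\<close>.\<close>
    have "norm (P n (E x - E (P n x))) \<le> (K * norm E * K * norm x) * exp (- \<alpha> * real j)" for j
    proof -
      define m where "m = n - int j"
      have m: "m \<in> J" "m + int j \<in> J" and nm: "n = m + int j"
        using n J by (auto simp: nonpos_ints_def m_def)
      have "P n (E x - E (P n x)) = ((iterate_op A m j o\<^sub>L P m) o\<^sub>L E o\<^sub>L G m j) x"
        using iterate_op_commute[of E A m j, OF E_A, symmetric] iterate_P[OF m] iterate_G[OF m, of x]
        by (simp add: nm flip: blinfun.diff_right)
      also have "norm \<dots> \<le> norm ((iterate_op A m j o\<^sub>L P m) o\<^sub>L E o\<^sub>L G m j) * norm x"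
        by (rule norm_blinfun)
      also have "\<dots> \<le> K * norm E * (K * exp (- \<alpha> * real j)) * norm x"
        using K_pos e[of j]
        by (intro mult_right_mono norm_blinfun_compose3_le order_trans[OF forward_bound[OF m]]
            G_bound[OF m]) auto
      finally show ?thesis by (simp add: algebra_simps)
    qed
    then have "P n (E x - E (P n x)) = 0"
      using \<alpha>_pos by (rule decay_imp_zero)
    then show ?thesis by (simp add: blinfun.diff_right)
  qed
  then show ?thesis by blast
qed

text \<open>Taking the diagonal part respects composition with operators that commute with
  \<open>E\<close>, so the identities for \<open>P\<close> and \<open>G\<close> carry over. The
  diagonal part \<open>H\<close> of \<open>G\<close> may leave the kernel of the new projection;
  subtracting \<open>P' n o\<^sub>L H n j\<close> corrects this.\<close>

lemma (in dichotomy_data) block_diagonal_dichotomy_data: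
  fixes E :: "'a \<Rightarrow>\<^sub>L 'a"
  assumes J: "J = nonneg_ints \<or> J = nonpos_ints"
    and E_idem: "\<And>x. E (E x) = E x" and E_A: "\<And>n x. E (A n x) = A n (E x)"
  obtains G' K' where "dichotomy_data J A (\<lambda>n. block_diagonal_part E (P n)) G' K' \<alpha>"
proof -
  define P' where "P' n = block_diagonal_part E (P n)" for n
  define H where "H n j = block_diagonal_part E (G n j)" for n j
  \<comment> \<open>The norm of \<open>block_diagonal_part E\<close> is at most \<open>c\<close>,
    the summand 1 making it positive. The factor \<open>1 + c * K\<close> in \<open>K'\<close>
    accounts for the correction of \<open>H\<close>.\<close>
  define c where "c = (norm E)\<^sup>2 + (norm (id_blinfun - E))\<^sup>2 + 1"
  define K' where "K' = (1 + c * K) * (c * K)"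
  have c: "c > 0"
    unfolding c_def by (intro add_nonneg_pos) auto
  have norm_diag: "norm (block_diagonal_part E T) \<le> c * norm T" for T
    using norm_block_diagonal_part[of E T] by (simp add: c_def distrib_right) (smt (verit) norm_ge_zero)
  have cK: "0 < c * K" "c * K \<le> K'"
    using c K_pos by (auto simp: K'_def)
  have P'_idem: "P' n (P' n x) = P' n x" if "n \<in> J" for n x
    \<comment> \<open>Either identity reduces the inner \<open>P E P\<close> in the square of a
      diagonal block to a single \<open>P\<close>, up to factors \<open>E\<close>.\<close>
    using range_or_kernel_invariant[OF J E_A]
  proof
    assume "\<forall>n\<in>J. \<forall>x. P n (E (P n x)) = E (P n x)"
    then have "P n (E (P n x)) = E (P n x)" for x using that by blast
    then show ?thesis
      by (simp add: P'_def block_diagonal_part_apply blinfun.bilinear_simps E_idem P_idem[OF that])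
  next
    assume "\<forall>n\<in>J. \<forall>x. P n (E (P n x)) = P n (E x)"
    then have "P n (E (P n x)) = P n (E x)" for x using that by blast
    then show ?thesis
      by (simp add: P'_def block_diagonal_part_apply blinfun.bilinear_simps E_idem P_idem[OF that])
  qed
  have E_iterate: "iterate_op A n j (E x) = E (iterate_op A n j x)" for n j x
    by (simp add: iterate_op_commute E_A)
  have "dichotomy_data J A P' (\<lambda>n j. H n j - (P' n o\<^sub>L H n j)) K' \<alpha>"
  proof unfold_locales
    show "K' > 0" "\<alpha> > 0"
      using cK \<alpha>_pos by auto
    show "b \<in> J" if "a \<in> J" "c \<in> J" "a \<le> b" "b \<le> c" for a b c
      using interval that .
    show "P' n (P' n x) = P' n x" if "n \<in> J" for n x
      using P'_idem that .
    show "A n (P' n x) = P' (n + 1) (A n x)" if "n \<in> J" "n + 1 \<in> J" for n x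
      by (simp add: P'_def block_diagonal_part_apply blinfun.bilinear_simps A_P[OF that] E_A flip: E_A)
    fix n j assume nj: "n \<in> J" "n + int j \<in> J"
    have HI: "H n j (iterate_op A n j x) = x - P' n x" for x
      using G_iterate[OF nj, of "E x"] G_iterate[OF nj, of x]
      by (simp add: P'_def H_def block_diagonal_part_apply blinfun.bilinear_simps E_idem E_iterate)
    show "(H n j - (P' n o\<^sub>L H n j)) (iterate_op A n j x) = x - P' n x" for x
      by (simp add: HI blinfun.bilinear_simps P'_idem nj)
    have IH: "iterate_op A n j (H n j x) = x - P' (n + int j) x" for x
      by (simp add: P'_def H_def block_diagonal_part_apply blinfun.bilinear_simps E_idem E_iterate
          iterate_G[OF nj])
    have IP: "iterate_op A n j (P' n x) = P' (n + int j) (iterate_op A n j x)" for x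
      by (simp add: P'_def block_diagonal_part_apply blinfun.bilinear_simps E_iterate iterate_P[OF nj])
    show "iterate_op A n j ((H n j - (P' n o\<^sub>L H n j)) x) = x - P' (n + int j) x" for x
      by (simp add: IH IP blinfun.bilinear_simps P'_idem nj)
    show "P' n ((H n j - (P' n o\<^sub>L H n j)) x) = 0" for x
      by (simp add: blinfun.bilinear_simps P'_idem nj)
    have "iterate_op A n j o\<^sub>L P' n = block_diagonal_part E (iterate_op A n j o\<^sub>L P n)"
      by (rule blinfun_eqI)
        (simp add: P'_def block_diagonal_part_apply blinfun.bilinear_simps E_iterate)
    then have "norm (iterate_op A n j o\<^sub>L P' n) \<le> c * (K * exp (- \<alpha> * real j))"
      using norm_diag[of "iterate_op A n j o\<^sub>L P n"] forward_bound[OF nj] c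
      by (smt (verit) mult_left_mono)
    also have "\<dots> \<le> K' * exp (- \<alpha> * real j)"
      using cK by (simp add: mult.assoc[symmetric])
    finally show "norm (iterate_op A n j o\<^sub>L P' n) \<le> K' * exp (- \<alpha> * real j)" .
    have "norm (P' n) \<le> c * K"
      using norm_diag[of "P n"] P_bound[OF nj(1)] c unfolding P'_def by (smt (verit) mult_left_mono)
    moreover have nH: "norm (H n j) \<le> c * (K * exp (- \<alpha> * real j))"
      using norm_diag[of "G n j"] G_bound[OF nj] c unfolding H_def by (smt (verit) mult_left_mono)
    ultimately have "norm (P' n o\<^sub>L H n j) \<le> (c * K) * (c * (K * exp (- \<alpha> * real j)))"
      using cK by (intro order_trans[OF norm_blinfun_compose] mult_mono) auto
    with nH have "norm (H n j - (P' n o\<^sub>L H n j)) \<le>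
        c * (K * exp (- \<alpha> * real j)) + (c * K) * (c * (K * exp (- \<alpha> * real j)))"
      by (intro order_trans[OF norm_triangle_ineq4] add_mono)
    then show "norm (H n j - (P' n o\<^sub>L H n j)) \<le> K' * exp (- \<alpha> * real j)"
      by (simp add: K'_def algebra_simps)
  qed
  then show ?thesis
    unfolding P'_def by (rule that)
qed

section \<open>Coefficients extended by zero and the decay of their products\<close>

text \<open>
  Extending the operators by zero to all of \<open>\<int>\<close> frees most identities and bounds below from side
  conditions on the times.
\<close>

locale triangular_dichotomy = dichotomy_data J A P G K \<alpha>
  for J :: "int set" and A P :: "int \<Rightarrow> 'a::banach \<Rightarrow>\<^sub>L 'a" and G K \<alpha> +
  fixes E :: "'a \<Rightarrow>\<^sub>L 'a" and N :: "int \<Rightarrow> 'a \<Rightarrow>\<^sub>L 'a" and M :: real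
  assumes E_A: "\<And>n x. E (A n x) = A n (E x)"
    and E_P: "\<And>n x. n \<in> J \<Longrightarrow> E (P n x) = P n (E x)"
    and E_N: "\<And>n x. E (N n x) = N n x" and N_E: "\<And>n x. N n (E x) = 0"
    and N_bound: "\<And>n. n \<in> J \<Longrightarrow> norm (N n) \<le> M" and M_nonneg: "M \<ge> 0"
begin

definition step :: "int \<Rightarrow> bool" where "step n \<longleftrightarrow> n \<in> J \<and> n + 1 \<in> J"
definition D :: "int \<Rightarrow> 'a \<Rightarrow>\<^sub>L 'a" where "D n = (if step n then A n else 0)"
definition R :: "int \<Rightarrow> 'a \<Rightarrow>\<^sub>L 'a" where "R n = (if step n then N n else 0)"
definition Q :: "int \<Rightarrow> 'a \<Rightarrow>\<^sub>L 'a" where "Q n = (if n \<in> J then P n else 0)"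
text \<open>The backward step from time \<open>n + 1\<close> to \<open>n\<close>, indexed by the
  earlier time like \<open>D n\<close>; the projection onto the kernel is built in.\<close>

definition B :: "int \<Rightarrow> 'a \<Rightarrow>\<^sub>L 'a" where "B n = (if step n then G n 1 else 0)"

lemma Q_idem [simp]: "Q n (Q n x) = Q n x"
  by (simp add: Q_def P_idem)

lemma D_Q: "D n (Q n x) = Q (n + 1) (D n x)"
  by (simp add: D_def Q_def step_def A_P)

lemma Q_B [simp]: "Q n (B n x) = 0"
  by (simp add: B_def Q_def step_def P_G)

lemma B_Q [simp]: "B n (Q (n + 1) x) = 0"
  using G_P[of n 1] by (simp add: B_def Q_def step_def)

lemma B_D: "step n \<Longrightarrow> B n (D n x) = x - Q n x"
  using G_iterate[of n 1] by (simp add: B_def D_def Q_def step_def)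

lemma D_B: "step n \<Longrightarrow> D n (B n x) = x - Q (n + 1) x"
  using iterate_G[of n 1] by (simp add: B_def D_def Q_def step_def)

lemma R_bound: "norm (R n) \<le> M"
  using N_bound M_nonneg by (simp add: R_def step_def)

lemma B_bound: "norm (B n) \<le> K"
proof -
  have "norm (G n 1) \<le> K * exp (- \<alpha>)" if "step n"
    using G_bound[of n 1] that by (simp add: step_def)
  also have "K * exp (- \<alpha>) \<le> K"
    using K_pos \<alpha>_pos by simp
  finally show ?thesis
    using K_pos by (simp add: B_def)
qed

lemma Q_bound: "norm (Q n) \<le> K"
  using P_bound K_pos by (simp add: Q_def less_imp_le)

lemma E_D: "E (D n x) = D n (E x)"
  by (simp add: D_def E_A)

lemma E_Q: "E (Q n x) = Q n (E x)"
  by (simp add: Q_def E_P)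

lemma E_R [simp]: "E (R n x) = R n x" and R_E [simp]: "R n (E x) = 0"
  by (simp_all add: R_def E_N N_E)

text \<open>Commutation with \<open>D\<close> passes to its inverse between the kernels of
  \<open>Q\<close>. This is applied to \<open>E\<close> and to scalar multiplications.\<close>

lemma B_commute:
  fixes U :: "'a \<Rightarrow>\<^sub>L 'a"
  assumes "\<And>x. U (D n x) = D n (U x)" "\<And>n x. U (Q n x) = Q n (U x)"
  shows "U (B n x) = B n (U x)"
proof (cases "step n")
  case True
  have "B n (D n (U (B n x))) = B n (U x)"
    by (simp add: D_B[OF True] blinfun.diff_right assms(2) flip: assms(1))
  then show ?thesis
    by (simp add: B_D[OF True] flip: assms(2))
qed (simp add: B_def)

lemmas E_B = B_commute[OF E_D E_Q]

text \<open>Inside \<open>J\<close> the intermediate projections merge into the one at time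
  \<open>n\<close>; a product leaving \<open>J\<close> contains a zero factor. The empty product is
  the identity rather than \<open>P n\<close>.\<close>

lemma iterate_DQ:
  "iterate_op (\<lambda>n. D n o\<^sub>L Q n) n j =
    (if j = 0 then id_blinfun else if n \<in> J \<and> n + int j \<in> J then iterate_op A n j o\<^sub>L P n else 0)"
proof (induction j)
  case (Suc j)
  have mem: "n + int j \<in> J" if "n \<in> J" "n + int j + 1 \<in> J"
    using interval[OF that, of "n + int j"] by simp
  show ?case
  proof (cases "n \<in> J \<and> n + int j + 1 \<in> J")
    case True
    then have J: "n \<in> J" "n + int j \<in> J" "n + int j + 1 \<in> J"
      using mem by auto
    have "P (n + int j) (iterate_op (\<lambda>n. D n o\<^sub>L Q n) n j x) = iterate_op A n j (P n x)" for x
      using J by (cases "j = 0") (simp_all add: Suc iterate_P P_idem)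
    moreover have "D (n + int j) = A (n + int j)" "Q (n + int j) = P (n + int j)"
      using J by (simp_all add: D_def Q_def step_def)
    ultimately show ?thesis
      using J by (intro blinfun_eqI) (simp add: algebra_simps)
  next
    case False
    have "iterate_op (\<lambda>n. D n o\<^sub>L Q n) n j = 0 \<or> Q (n + int j) = 0 \<or> D (n + int j) = 0"
    proof (cases "n \<in> J")
      case True
      with False have "D (n + int j) = 0" by (simp add: D_def step_def)
      then show ?thesis by blast
    next
      case False
      then show ?thesis
      proof (cases "j = 0")
        case True
        with \<open>n \<notin> J\<close> show ?thesis by (simp add: Q_def)
      qed (simp add: Suc)
    qed
    with False show ?thesis
      by (intro blinfun_eqI) (auto simp: algebra_simps)
  qed
qed simp

text \<open>The left side is the product B(n-j) ... B(n-1), leading from time \<open>n\<close> back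
  to \<open>n - j\<close>; within \<open>J\<close>, \<open>G_unique\<close> recognizes it.\<close>

lemma iterate_reversed_B:
  "iterate_op (time_reversal B) (- n) j =
    (if j = 0 then id_blinfun else if n \<in> J \<and> n - int j \<in> J then G (n - int j) j else 0)"
proof (induction j)
  case (Suc j)
  define m where "m = n - int j - 1"
  have m: "time_reversal B (- n + int j) = B m" "n = m + int (Suc j)" "n - int j = m + 1"
    by (auto simp: time_reversal_def m_def algebra_simps)
  have mem: "m + 1 \<in> J" if "m \<in> J" "n \<in> J"
    using interval[OF that, of "m + 1"] m by simp
  show ?case
  proof (cases "n \<in> J \<and> m \<in> J")
    case True
    then have J: "m \<in> J" "m + 1 \<in> J" "n \<in> J" "m + 1 + int j \<in> J" "m + int (Suc j) \<in> J"
      using mem m by (auto simp: algebra_simps)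
    have P_IH: "P (m + 1) (iterate_op (time_reversal B) (- n) j x) = 0"
        and D_IH: "iterate_op A (m + 1) j (iterate_op (time_reversal B) (- n) j x) = x - P n x"
      if "j > 0" for x
    proof -
      have "iterate_op (time_reversal B) (- n) j = G (m + 1) j"
        using Suc that J m(3) by simp
      moreover have "m + 1 + int j = n"
        by (simp add: m_def)
      ultimately show "P (m + 1) (iterate_op (time_reversal B) (- n) j x) = 0"
          "iterate_op A (m + 1) j (iterate_op (time_reversal B) (- n) j x) = x - P n x"
        using P_G[OF J(2,4)] iterate_G[OF J(2,4)] by simp_all
    qed
    have "B m (iterate_op (time_reversal B) (- n) j x) = G m (Suc j) x" for x
    proof (rule G_unique[OF J(1,5)])
      fix x
      show "P m (B m (iterate_op (time_reversal B) (- n) j x)) = 0"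
        using Q_B[of m] J(1) by (simp add: Q_def)
      have "iterate_op A m (Suc j) (B m (iterate_op (time_reversal B) (- n) j x)) =
          iterate_op A (m + 1) j (iterate_op (time_reversal B) (- n) j x
            - P (m + 1) (iterate_op (time_reversal B) (- n) j x))"
        using D_B[of m] J unfolding iterate_op_Suc_right by (simp add: step_def D_def Q_def)
      also have "\<dots> = x - P n x"
        using P_IH[of x] D_IH[of x] m(2) by (cases "j = 0") auto
      finally show "iterate_op A m (Suc j) (B m (iterate_op (time_reversal B) (- n) j x)) =
          x - P (m + int (Suc j)) x"
        using m(2) by simp
    qed
    moreover have "n - int (Suc j) = m" by (simp add: m_def)
    ultimately show ?thesis
      using True m(1) by (intro blinfun_eqI) simp
  next
    case False
    have "iterate_op (time_reversal B) (- n) j = 0 \<or> B m = 0"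
    proof (cases "m \<in> J")
      case True
      with False have n: "n \<notin> J" by simp
      show ?thesis
      proof (cases "j = 0")
        case True
        with m(3) n show ?thesis by (simp add: B_def step_def)
      qed (use n Suc in simp)
    qed (simp add: B_def step_def)
    moreover have "n - int (Suc j) = m" by (simp add: m_def)
    ultimately show ?thesis
      using False m(1) by (intro blinfun_eqI) auto
  qed
qed simp

text \<open>The maximum with 1 also covers the empty products, which are the identity.\<close>

definition K1 :: real where "K1 = max 1 K"

lemma K1: "K1 \<ge> 1" "K1 \<ge> K" by (simp_all add: K1_def)

lemma le_K1: "x \<le> K * exp t \<Longrightarrow> x \<le> K1 * exp t"
  by (erule order_trans) (simp add: K1)

lemma iterate_DQ_bound: "norm (iterate_op (\<lambda>n. D n o\<^sub>L Q n) n j) \<le> K1 * exp (- \<alpha> * real j)"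
  using forward_bound[of n j] order_trans[OF norm_blinfun_id_le K1(1)] K1
  unfolding iterate_DQ by (auto intro!: le_K1)

lemma iterate_reversed_B_bound:
  "norm (iterate_op (time_reversal B) n j) \<le> K1 * exp (- \<alpha> * real j)"
  using G_bound[of "- n - int j" j] order_trans[OF norm_blinfun_id_le K1(1)] K1
    iterate_reversed_B[of "- n" j]
  by (auto intro!: le_K1)

section \<open>Decoupling range and kernel; the dichotomy of the perturbed system\<close>

text \<open>
  The solution is assembled from its parts mapping the kernel of \<open>Q\<close> to the range and the range to
  the kernel; for the latter the equation is solved backwards in time.
\<close>

lemma ex_decoupling:
  obtains W :: "int \<Rightarrow> 'a \<Rightarrow>\<^sub>L 'a" and w where "\<And>n. norm (W n) \<le> w"
    and "\<And>n x. E (W n x) = W n x" and "\<And>n x. W n (E x) = 0"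
    and "\<And>n x. W (n + 1) (D n x) - D n (W n x) =
      Q (n + 1) (R n (x - Q n x)) + (R n (Q n x) - Q (n + 1) (R n (Q n x)))"
    and "\<forall>U. intertwines U U D \<and> intertwines U U Q \<and> intertwines U U R \<longrightarrow> intertwines U U W"
proof -
  have KMK: "K1 * M * K1 \<ge> 0" using K1 M_nonneg by simp
  have b: "norm (Q n) \<le> K1" "norm (B n) \<le> K1" for n
    using Q_bound[of n] B_bound[of n] K1 by auto
  \<comment> \<open>Composed with \<open>B n\<close> on the right, the equation for the part with
    values in the range becomes a recursion forwards in time.\<close>
  have F1: "norm (Q (n + 1) o\<^sub>L R n o\<^sub>L B n) \<le> K1 * M * K1" for n
    using b R_bound by (intro norm_blinfun_compose3_le)
  obtain Z1 :: "int \<Rightarrow> 'a \<Rightarrow>\<^sub>L 'a" and c1 where Z1_bound: "\<And>n. norm (Z1 n) \<le> c1"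
    and Z1: "\<And>n x. Z1 (n + 1) x = (D n o\<^sub>L Q n) (Z1 n (B n x)) + (Q (n + 1) o\<^sub>L R n o\<^sub>L B n) x"
    and Z1_comm: "\<forall>U V. intertwines U U (\<lambda>n. D n o\<^sub>L Q n) \<and> intertwines V V B \<and>
        intertwines U V (\<lambda>n. Q (n + 1) o\<^sub>L R n o\<^sub>L B n) \<longrightarrow> intertwines U V Z1"
    by (rule ex_bounded_sylvester_solution[OF iterate_DQ_bound iterate_reversed_B_bound F1 \<alpha>_pos KMK])
      (rule that, assumption+)
  \<comment> \<open>Composed with \<open>B n\<close> on the left, the equation for the part with
    values in the kernel determines time \<open>n\<close> from time \<open>n + 1\<close>. Reversing
    time makes this a forward recursion, solved by \<open>Z\<close> with
    \<open>Z2 n = Z (- n)\<close>.\<close>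
  define F where "F n = - (B (- n - 1) o\<^sub>L R (- n - 1) o\<^sub>L Q (- n - 1))" for n
  have F2: "norm (F n) \<le> K1 * M * K1" for n
    unfolding F_def norm_minus_cancel using b R_bound by (intro norm_blinfun_compose3_le)
  have DQ: "norm (iterate_op (time_reversal (time_reversal (\<lambda>n. D n o\<^sub>L Q n))) n j) \<le> K1 * exp (- \<alpha> * real j)" for n j
    using iterate_DQ_bound by simp
  obtain Z :: "int \<Rightarrow> 'a \<Rightarrow>\<^sub>L 'a" and c2 where Z_bound: "\<And>n. norm (Z n) \<le> c2"
    and Z: "\<And>n x. Z (n + 1) x =
      time_reversal B n (Z n (time_reversal (\<lambda>n. D n o\<^sub>L Q n) n x)) + F n x"
    and Z_comm: "\<forall>U V. intertwines U U (time_reversal B) \<and>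
        intertwines V V (time_reversal (\<lambda>n. D n o\<^sub>L Q n)) \<and> intertwines U V F \<longrightarrow> intertwines U V Z"
    by (rule ex_bounded_sylvester_solution[OF iterate_reversed_B_bound DQ F2 \<alpha>_pos KMK])
      (rule that, assumption+)
  define Z2 where "Z2 n = Z (- n)" for n
  have Z2: "Z2 n x = B n (Z2 (n + 1) (D n (Q n x))) - B n (R n (Q n x))" for n x
    using Z[of "- n - 1" x] by (simp add: Z2_def time_reversal_def F_def blinfun.bilinear_simps)
  define W where "W n = Z1 n + Z2 n" for n
  have comm: "intertwines U V W"
    if "\<And>n x. U (D n (Q n x)) = D n (Q n (U x))" "\<And>n x. V (D n (Q n x)) = D n (Q n (V x))"
      "\<And>n x. U (B n x) = B n (U x)" "\<And>n x. V (B n x) = B n (V x)"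
      "\<And>n x. U (Q (n + 1) (R n (B n x))) = Q (n + 1) (R n (B n (V x)))"
      "\<And>n x. U (B n (R n (Q n x))) = B n (R n (Q n (V x)))"
    for U V :: "'a \<Rightarrow>\<^sub>L 'a"
  proof -
    have "intertwines U V Z1"
      by (rule Z1_comm[rule_format]) (simp add: intertwines_def that)
    moreover have "intertwines U V Z"
    proof (rule Z_comm[rule_format], intro conjI)
      show "intertwines U U (time_reversal B)"
        by (simp add: intertwines_def time_reversal_def that(3))
      show "intertwines V V (time_reversal (\<lambda>n. D n o\<^sub>L Q n))"
        by (simp add: intertwines_def time_reversal_def that(2))
      show "intertwines U V F"
        by (simp add: intertwines_def F_def blinfun.bilinear_simps that(6))
    qed
    ultimately show ?thesis
      by (simp add: intertwines_def W_def Z2_def blinfun.bilinear_simps)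
  qed
  have Z1': "Z1 n x = Q n (D (n - 1) (Z1 (n - 1) (B (n - 1) x))) + Q n (R (n - 1) (B (n - 1) x))" for n x
    using Z1[of "n - 1" x] D_Q[of "n - 1"] by simp
  have Q_Z1: "Q n (Z1 n x) = Z1 n x" for n x
    unfolding Z1'[of n x] by (simp add: blinfun.add_right)
  have Z1_Q: "Z1 n (Q n x) = 0" for n x
    using B_Q[of "n - 1"] by (simp add: Z1'[of n "Q n x"])
  have Q_Z2: "Q n (Z2 n x) = 0" for n x
    by (simp add: Z2[of n x] blinfun.diff_right)
  have Z2_Q: "Z2 n (Q n x) = Z2 n x" for n x
    by (simp add: Z2[of n "Q n x"] Z2[of n x])
  show ?thesis
  proof (rule that[of W "c1 + c2"])
    fix n x
    show "norm (W n) \<le> c1 + c2"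
      unfolding W_def Z2_def using Z1_bound Z_bound by (intro order_trans[OF norm_triangle_ineq] add_mono)
    \<comment> \<open>The pair \<open>E\<close>, \<open>id_blinfun\<close> says that the values lie
      in the range of \<open>E\<close>; the pair \<open>0\<close>, \<open>E\<close> below says that
      \<open>W\<close> vanishes on that range. Both are inherited from the factor \<open>R\<close>
      in the inhomogeneities.\<close>
    have "intertwines E id_blinfun W"
      by (rule comm) (simp_all add: E_D E_Q E_B)
    then show "E (W n x) = W n x"
      by (simp add: intertwines_def)
    have "intertwines 0 E W"
      by (rule comm) (simp_all flip: E_D E_Q E_B)
    then show "W n (E x) = 0"
      by (simp add: intertwines_def)
    show "W (n + 1) (D n x) - D n (W n x) =
        Q (n + 1) (R n (x - Q n x)) + (R n (Q n x) - Q (n + 1) (R n (Q n x)))"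
    proof (cases "step n")
      case True
      have "Z1 (n + 1) (D n x) = D n (Z1 n x) + Q (n + 1) (R n (x - Q n x))"
        using Z1[of n "D n x"] by (simp add: B_D[OF True] blinfun.diff_right Z1_Q Q_Z1)
      moreover have "D n (Z2 n x) = Z2 (n + 1) (D n x) - (R n (Q n x) - Q (n + 1) (R n (Q n x)))"
        by (simp add: Z2[of n x] D_B[OF True] blinfun.diff_right Q_Z2) (simp add: D_Q Z2_Q)
      ultimately show ?thesis
        by (simp add: W_def blinfun.bilinear_simps)
    qed (simp add: D_def R_def)
  next
    have "intertwines U U W" if "intertwines U U D" "intertwines U U Q" "intertwines U U R" for U
    proof -
      note U = that[THEN intertwinesD]
      have "U (B n x) = B n (U x)" for n x
        using U by (intro B_commute)
      with U show ?thesis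
        by (intro comm) simp_all
    qed
    then show "\<forall>U. intertwines U U D \<and> intertwines U U Q \<and> intertwines U U R \<longrightarrow> intertwines U U W"
      by blast
  qed
qed

text \<open>
  With \<open>W\<close> as above, conjugation by \<open>Id + W\<close> removes the parts of \<open>R\<close> that couple the range and the
  kernel of \<open>Q\<close>: \<open>D + R\<close> becomes \<open>T\<close>, which commutes with \<open>Q\<close>. On the range it is a nilpotent
  perturbation of \<open>D\<close>; on the kernel its inverse \<open>C\<close> is a nilpotent perturbation of \<open>B\<close>.
\<close>

lemma dichotomy_data_perturbed:
  obtains P' G' K' where "dichotomy_data J (\<lambda>n. A n + N n) P' G' K' (\<alpha> / 2)"
    and "\<forall>U. intertwines U U D \<and> intertwines U U Q \<and> intertwines U U R \<longrightarrow> intertwines U U P'"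
proof -
  obtain W :: "int \<Rightarrow> 'a \<Rightarrow>\<^sub>L 'a" and w where W_bound: "\<And>n. norm (W n) \<le> w"
    and E_W: "\<And>n x. E (W n x) = W n x" and W_E: "\<And>n x. W n (E x) = 0"
    and W: "\<And>n x. W (n + 1) (D n x) - D n (W n x) =
      Q (n + 1) (R n (x - Q n x)) + (R n (Q n x) - Q (n + 1) (R n (Q n x)))"
    and W_comm: "\<forall>U. intertwines U U D \<and> intertwines U U Q \<and> intertwines U U R \<longrightarrow> intertwines U U W"
    by (rule ex_decoupling) (rule that, assumption+)
  have w: "w \<ge> 0" using order_trans[OF norm_ge_zero W_bound] .
  \<comment> \<open>Each product has two strictly triangular factors, separated at most by operators
    commuting with \<open>E\<close>, and therefore vanishes.\<close>
  have WW [simp]: "W m (W n x) = 0" and RW [simp]: "R m (W n x) = 0" and WR [simp]: "W m (R n x) = 0"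
    and WQR [simp]: "W m (Q k (R n x)) = 0" and RBR [simp]: "R m (B k (R n x)) = 0"
    and RQR [simp]: "R m (Q k (R n x)) = 0" and RBQR [simp]: "R m (B k (Q l (R n x))) = 0" for k l m n x
    using W_E[of m "W n x"] R_E[of m "W n x"] W_E[of m "R n x"] W_E[of m "Q k (R n x)"]
      R_E[of m "B k (R n x)"] R_E[of m "Q k (R n x)"] R_E[of m "B k (Q l (R n x))"]
    by (simp_all add: E_W E_Q E_B)
  \<comment> \<open>Since products of two \<open>W\<close> vanish, Id - W is the exact inverse of Id
    + W.\<close>
  define S where "S n = id_blinfun + W n" for n
  define S' where "S' n = id_blinfun - W n" for n
  have S_S' [simp]: "S n (S' n x) = x" and S'_S [simp]: "S' n (S n x) = x" for n x
    by (simp_all add: S_def S'_def blinfun.bilinear_simps)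
  define T where "T n = D n + (Q (n + 1) o\<^sub>L R n o\<^sub>L Q n)
    + ((id_blinfun - Q (n + 1)) o\<^sub>L R n o\<^sub>L (id_blinfun - Q n))" for n
  have T: "T n x = D n x + Q (n + 1) (R n (Q n x)) + (R n (x - Q n x) - Q (n + 1) (R n (x - Q n x)))" for n x
    by (simp add: T_def blinfun.bilinear_simps)
  \<comment> \<open>With \<open>R W\<close> and \<open>W R\<close> gone, this is the equation solved
    by \<open>W\<close>: its right side is \<open>R\<close> minus the two parts kept in
    \<open>T\<close>.\<close>
  have conj: "(D n + R n) (S n x) = S (n + 1) (T n x)" for n x
    using W[of n x] by (simp add: S_def T blinfun.bilinear_simps algebra_simps)
  have T_Q: "T n (Q n x) = Q (n + 1) (T n x)" for n x
    by (simp add: T blinfun.bilinear_simps D_Q)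
  \<comment> \<open>A Neumann series for the inverse of \<open>T\<close> on the kernel; it stops
    after the linear term because \<open>R B R\<close> is zero.\<close>
  define C where "C n = B n - (B n o\<^sub>L R n o\<^sub>L B n)" for n
  have C_T: "C n (T n x) = x - Q n x" if "step n" for n x
    by (simp add: C_def T blinfun.bilinear_simps B_D[OF that])
  have Q_C [simp]: "Q n (C n x) = 0" and C_Q [simp]: "C n (Q (n + 1) x) = 0" for n x
    by (simp_all add: C_def blinfun.bilinear_simps)
  have T_C: "T n (C n x) = x - Q (n + 1) x" if "step n" for n x
    by (simp add: T) (simp add: C_def blinfun.bilinear_simps D_B[OF that])
  have conj_iterate: "iterate_op (\<lambda>n. D n + R n) n j (S n x) = S (n + int j) (iterate_op T n j x)" for n j x
    by (induction j) (simp_all add: conj algebra_simps)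
  have iterate_T_Q: "iterate_op T n j (Q n x) = Q (n + int j) (iterate_op T n j x)" for n j x
    by (induction j) (simp_all add: T_Q algebra_simps)
  define X where "X n = (D n o\<^sub>L Q n) + (Q (n + 1) o\<^sub>L R n o\<^sub>L Q n)" for n
  have iterate_X: "iterate_op X n j (Q n x) = iterate_op T n j (Q n x)" for n j x
  proof (induction j)
    case (Suc j)
    have "X m (Q m y) = T m (Q m y)" for m y
      by (simp add: X_def T blinfun.bilinear_simps)
    with Suc show ?case by (simp add: iterate_T_Q)
  qed simp
  \<comment> \<open>This is the product C(n) ... C(n+j-1), leading back from \<open>n + j\<close> to
    \<open>n\<close>. For \<open>j = 0\<close> it is the identity, so the identities below apply it
    after Id - Q.\<close>
  define \<Gamma> where "\<Gamma> n j = iterate_op (time_reversal C) (- n - int j) j" for n j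
  have \<Gamma>_Suc: "\<Gamma> n (Suc j) x = \<Gamma> n j (C (n + int j) x)" for n j x
    using iterate_op_Suc_right[of "time_reversal C" "- n - int (Suc j)" j]
    by (simp add: \<Gamma>_def time_reversal_def algebra_simps)
  have steps: "step (n + int j)" "n + int j \<in> J" if "n \<in> J" "n + int (Suc j) \<in> J" for n j
    using interval[OF that, of "n + int j"] that by (auto simp: step_def algebra_simps)
  have \<Gamma>_T: "\<Gamma> n j (iterate_op T n j x - Q (n + int j) (iterate_op T n j x)) = x - Q n x"
    if "n \<in> J" "n + int j \<in> J" for n j x
    using that(2)
  proof (induction j)
    case 0
    then show ?case by (simp add: \<Gamma>_def)
  next
    case (Suc j)
    note st = steps[OF that(1) Suc.prems]
    have "C (n + int j) (Q (n + int (Suc j)) y) = 0" for y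
      using C_Q[of "n + int j" y] by (simp add: algebra_simps)
    then show ?case
      using Suc.IH[OF st(2)] by (simp add: \<Gamma>_Suc blinfun.diff_right C_T[OF st(1)])
  qed
  have T_\<Gamma>: "iterate_op T n j (\<Gamma> n j (x - Q (n + int j) x)) = x - Q (n + int j) x"
    and Q_\<Gamma>: "Q n (\<Gamma> n j (x - Q (n + int j) x)) = 0"
    if "n \<in> J" "n + int j \<in> J" for n j x
    using that(2)
  proof (induction j arbitrary: x)
    case 0
    {
      case 1
      then show ?case by (simp add: \<Gamma>_def)
    next
      case 2
      then show ?case by (simp add: \<Gamma>_def blinfun.diff_right)
    }
  next
    case (Suc j)
    have *: "n + int (Suc j) = n + int j + 1" by simp
    {
      case 1
      note st = steps[OF that(1) 1]
      show ?case
        using Suc.IH(1)[OF st(2), of "C (n + int j) x"] unfolding *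
        by (simp add: \<Gamma>_Suc blinfun.diff_right T_C[OF st(1)])
    next
      case 2
      note st = steps[OF that(1) 2]
      show ?case
        using Suc.IH(2)[OF st(2), of "C (n + int j) x"] unfolding *
        by (simp add: \<Gamma>_Suc blinfun.diff_right)
    }
  qed
  define P' where "P' n = S n o\<^sub>L Q n o\<^sub>L S' n" for n
  define G' where "G' n j = (S n o\<^sub>L \<Gamma> n j) o\<^sub>L (id_blinfun - Q (n + int j)) o\<^sub>L S' (n + int j)" for n j
  define L where "L = K1 + K1 * K1 * (K1 * M * K1) * exp \<alpha> * 2 / \<alpha>"
  have M': "K1 * M * K1 \<ge> 0" using K1 M_nonneg by simp
  have L: "L \<ge> 0" using K1 M_nonneg \<alpha>_pos by (simp add: L_def)
  have b: "norm (Q n) \<le> K1" "norm (B n) \<le> K1" for n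
    using Q_bound[of n] B_bound[of n] K1 by auto
  have X_bound: "norm (iterate_op X n j) \<le> L * exp (- (\<alpha> / 2) * real j)" for n j
    unfolding X_def L_def
  proof (rule nilpotent_perturbation_decay[where E = E])
    show "norm (Q (n + 1) o\<^sub>L R n o\<^sub>L Q n) \<le> K1 * M * K1" for n
      by (intro norm_blinfun_compose3_le b R_bound)
  qed (use iterate_DQ_bound \<alpha>_pos M' in \<open>simp_all add: E_D E_Q\<close>, simp_all flip: E_Q)
  have \<Gamma>_bound: "norm (\<Gamma> n j) \<le> L * exp (- (\<alpha> / 2) * real j)" for n j
  proof -
    have "time_reversal C = (\<lambda>i. time_reversal B i + time_reversal (\<lambda>n. - (B n o\<^sub>L R n o\<^sub>L B n)) i)"
      by (rule ext) (simp add: time_reversal_def C_def)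
    moreover have "norm (iterate_op \<dots> m j) \<le> L * exp (- (\<alpha> / 2) * real j)" for m
      unfolding L_def
    proof (rule nilpotent_perturbation_decay[where E = E])
      show "norm (time_reversal (\<lambda>n. - (B n o\<^sub>L R n o\<^sub>L B n)) n) \<le> K1 * M * K1" for n
        unfolding time_reversal_def norm_minus_cancel by (intro norm_blinfun_compose3_le b R_bound)
      show "norm (iterate_op (time_reversal B) n j) \<le> K1 * exp (- \<alpha> * real j)" for n j
        by (rule iterate_reversed_B_bound)
    qed (use \<alpha>_pos M' in
        \<open>simp_all add: time_reversal_def blinfun.bilinear_simps E_B\<close>, simp_all flip: E_B)
    ultimately show ?thesis by (simp add: \<Gamma>_def)
  qed
  \<comment> \<open>The factors bound \<open>S\<close>, an evolution on the range or the kernel,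
    \<open>Q\<close> or Id - Q, and \<open>S'\<close>; using \<open>L + 1\<close> ensures
    positivity.\<close>
  define K' where "K' = (1 + w) * (L + 1) * (1 + K1) * (1 + w)"
  have S_bound: "norm (S n) \<le> 1 + w" and S'_bound: "norm (S' n) \<le> 1 + w"
    and Q'_bound: "norm (id_blinfun - Q n) \<le> 1 + K1" for n
    unfolding S_def S'_def using norm_blinfun_id_le W_bound b
    by (auto intro!: order_trans[OF norm_triangle_ineq] order_trans[OF norm_triangle_ineq4] add_mono)
  have iterate_AN: "iterate_op (\<lambda>n. A n + N n) n j = iterate_op (\<lambda>n. D n + R n) n j"
    if "n \<in> J" "n + int j \<in> J" for n j
  proof (rule iterate_op_cong)
    fix i assume "i < j"
    then have "n + int i \<in> J" "n + int i + 1 \<in> J"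
      using interval[OF that, of "n + int i"] interval[OF that, of "n + int i + 1"] by auto
    then show "A (n + int i) + N (n + int i) = D (n + int i) + R (n + int i)"
      by (simp add: D_def R_def step_def)
  qed
  have iterate_S: "iterate_op (\<lambda>n. A n + N n) n j (S n x) = S (n + int j) (iterate_op T n j x)"
    if "n \<in> J" "n + int j \<in> J" for n j x
    using that by (simp add: iterate_AN conj_iterate)
  have S'_iterate: "S' (n + int j) (iterate_op (\<lambda>n. A n + N n) n j x) = iterate_op T n j (S' n x)"
    if "n \<in> J" "n + int j \<in> J" for n j x
    using iterate_S[OF that, of "S' n x"] by simp
  have "dichotomy_data J (\<lambda>n. A n + N n) P' G' K' (\<alpha> / 2)"
  proof unfold_locales
    show "K' > 0"
      unfolding K'_def using w L K1 by (intro mult_pos_pos) auto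
    show "\<alpha> / 2 > 0" using \<alpha>_pos by simp
    show "b \<in> J" if "a \<in> J" "c \<in> J" "a \<le> b" "b \<le> c" for a b c
      using interval that .
    show "P' n (P' n x) = P' n x" for n x
      by (simp add: P'_def)
    show "(A n + N n) (P' n x) = P' (n + 1) ((A n + N n) x)" if "n \<in> J" "n + 1 \<in> J" for n x
      using iterate_S[of n 1 "Q n (S' n x)"] S'_iterate[of n 1 x] that
      by (simp add: P'_def T_Q)
    fix n j assume nj: "n \<in> J" "n + int j \<in> J"
    show "G' n j (iterate_op (\<lambda>n. A n + N n) n j x) = x - P' n x" for x
      by (simp add: G'_def P'_def S'_iterate[OF nj] blinfun.diff_left \<Gamma>_T[OF nj])
        (simp add: blinfun.diff_right)
    show "iterate_op (\<lambda>n. A n + N n) n j (G' n j x) = x - P' (n + int j) x" for x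
      by (simp add: G'_def P'_def iterate_S[OF nj] blinfun.diff_left T_\<Gamma>[OF nj])
        (simp add: blinfun.diff_right)
    show "P' n (G' n j x) = 0" for x
      by (simp add: G'_def P'_def blinfun.diff_left Q_\<Gamma>[OF nj])
    have e: "(1 + w) * (L * exp (- (\<alpha> / 2) * real j)) * (1 + K1) * (1 + w) \<le> K' * exp (- (\<alpha> / 2) * real j)"
    proof -
      have "L * ((1 + w) * (1 + K1) * (1 + w) * exp (- (\<alpha> / 2) * real j))
          \<le> (L + 1) * ((1 + w) * (1 + K1) * (1 + w) * exp (- (\<alpha> / 2) * real j))"
        using w K1 by (intro mult_right_mono mult_nonneg_nonneg) auto
      then show ?thesis
        by (simp add: K'_def mult_ac)
    qed
    have "iterate_op (\<lambda>n. A n + N n) n j o\<^sub>L P' n = (S (n + int j) o\<^sub>L iterate_op X n j o\<^sub>L Q n) o\<^sub>L id_blinfun o\<^sub>L S' n"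
      by (rule blinfun_eqI) (simp add: P'_def iterate_S[OF nj] iterate_X)
    also have "norm \<dots> \<le> ((1 + w) * (L * exp (- (\<alpha> / 2) * real j)) * (1 + K1)) * 1 * (1 + w)"
      by (intro norm_blinfun_compose3_le S_bound S'_bound X_bound norm_blinfun_id_le
          order_trans[OF b(1)]) simp
    also have "\<dots> = (1 + w) * (L * exp (- (\<alpha> / 2) * real j)) * (1 + K1) * (1 + w)"
      by simp
    also note e
    finally show "norm (iterate_op (\<lambda>n. A n + N n) n j o\<^sub>L P' n) \<le> K' * exp (- (\<alpha> / 2) * real j)"
      .
    have "norm (G' n j) \<le> ((1 + w) * (L * exp (- (\<alpha> / 2) * real j))) * (1 + K1) * (1 + w)"
      unfolding G'_def
      by (intro norm_blinfun_compose3_le S'_bound Q'_bound order_trans[OF norm_blinfun_compose]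
          mult_mono S_bound \<Gamma>_bound) (use w in auto)
    also note e
    finally show "norm (G' n j) \<le> K' * exp (- (\<alpha> / 2) * real j)" .
  qed
  moreover have "intertwines U U P'" if "intertwines U U D" "intertwines U U Q" "intertwines U U R" for U
  proof -
    have "intertwines U U W" using W_comm that by blast
    from this[THEN intertwinesD] that(2)[THEN intertwinesD] show ?thesis
      by (simp add: intertwines_def P'_def S_def S'_def blinfun.bilinear_simps)
  qed
  ultimately show ?thesis
    by (intro that[of P' G' K']) auto
qed

end

section \<open>Scalar multiplications, block operators and the conclusion\<close>

lemma (in normed_scaling) bounded_linear_scaling: "bounded_linear (s c)"
proof (rule bounded_linear_intro)
  show "s c (r *\<^sub>R x) = r *\<^sub>R s c x" for r x
    by (simp add: mult.commute flip: scaling_of_real)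
  show "norm (s c x) \<le> norm x * norm c" for x
    by (simp add: norm_scaling mult.commute)
qed (rule scale_right_distrib)

lemma bounded_ops_iff:
  assumes "vector_space s" "vector_space t"
  shows "T \<in> bounded_ops s t \<longleftrightarrow> (\<forall>c x. T (s c x) = t c (T x))"
  using assms by (simp add: bounded_ops_def Vector_Spaces.linear_iff blinfun.add_right)

lemma norm_block_op_upper_le: "norm (block_op 0 B 0 0) \<le> norm B"
proof (rule norm_blinfun_bound)
  fix x :: "'a \<times> 'b"
  obtain a b where x: "x = (a, b)" by (cases x)
  have "norm (B b) \<le> norm B * norm b" by (rule norm_blinfun)
  also have "\<dots> \<le> norm B * norm (a, b)"
    by (intro mult_left_mono norm_snd_le) simp
  finally show "norm (block_op 0 B 0 0 x) \<le> norm B * norm x"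
    by (simp add: x norm_Pair)
qed simp

theorem theorem5:
  fixes s1 :: "'k::real_normed_field \<Rightarrow> 'a::{real_inner, banach} \<Rightarrow> 'a"
    and s2 :: "'k \<Rightarrow> 'b::{real_inner, banach} \<Rightarrow> 'b"
    and J :: "int set"
    and A11 :: "int \<Rightarrow> 'a \<Rightarrow>\<^sub>L 'a"
    and A12 :: "int \<Rightarrow> 'b \<Rightarrow>\<^sub>L 'a"
    and A22 :: "int \<Rightarrow> 'b \<Rightarrow>\<^sub>L 'b"
  assumes "normed_scaling s1" and "normed_scaling s2"
    and "J = nonneg_ints \<or> J = nonpos_ints"
    and "\<And>n. n \<in> J \<Longrightarrow> A11 n \<in> bounded_ops s1 s1"
    and "\<And>n. n \<in> J \<Longrightarrow> A12 n \<in> bounded_ops s2 s1"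
    and "\<And>n. n \<in> J \<Longrightarrow> A22 n \<in> bounded_ops s2 s2"
    and "exponential_dichotomy (module_prod.scale s1 s2) J (\<lambda>n. block_op (A11 n) 0 0 (A22 n))"
    and "bdd_above ((\<lambda>n. norm (A12 n)) ` J)"
  shows "exponential_dichotomy (module_prod.scale s1 s2) J (\<lambda>n. block_op (A11 n) (A12 n) 0 (A22 n))"
proof -
  interpret S1: normed_scaling s1 by fact
  interpret S2: normed_scaling s2 by fact
  interpret vector_space_prod s1 s2 by unfold_locales
  note A11 = assms(4)[unfolded bounded_ops_iff[OF S1.vector_space_axioms S1.vector_space_axioms], rule_format]
    and A12 = assms(5)[unfolded bounded_ops_iff[OF S2.vector_space_axioms S1.vector_space_axioms], rule_format]
    and A22 = assms(6)[unfolded bounded_ops_iff[OF S2.vector_space_axioms S2.vector_space_axioms], rule_format]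
    and ops_iff = bounded_ops_iff[OF p.vector_space_axioms p.vector_space_axioms]
  define A where "A n = block_op (A11 n) 0 0 (A22 n)" for n
  define N where "N n = block_op 0 (A12 n) 0 0" for n
  define E :: "('a \<times> 'b) \<Rightarrow>\<^sub>L ('a \<times> 'b)" where "E = block_op id_blinfun 0 0 0"
  have E_A: "E (A n x) = A n (E x)" for n x
    by (cases x) (simp add: E_def A_def)
  have E_idem: "E (E x) = E x" for x
    by (cases x) (simp add: E_def)
  obtain P G K \<alpha> where data: "dichotomy_data J A P G K \<alpha>"
    and P: "\<And>n. n \<in> J \<Longrightarrow> P n \<in> bounded_ops scale scale"
    by (rule exponential_dichotomy_imp_dichotomy_data[OF assms(3) assms(7)[folded A_def]])
      (rule that, assumption+)
  \<comment> \<open>The perturbation argument requires projections commuting with \<open>E\<close>,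
    hence the diagonal part.\<close>
  define P0 where "P0 n = block_diagonal_part E (P n)" for n
  obtain G0 K0 where "dichotomy_data J A P0 G0 K0 \<alpha>"
    by (rule dichotomy_data.block_diagonal_dichotomy_data[OF data assms(3) E_idem E_A, folded P0_def])
      (rule that)
  then interpret dichotomy_data J A P0 G0 K0 \<alpha> .
  obtain M where M: "\<And>n. n \<in> J \<Longrightarrow> norm (A12 n) \<le> M"
    using assms(8) by (auto simp: bdd_above_def)
  interpret triangular_dichotomy J A P0 G0 K0 \<alpha> E N "\<bar>M\<bar>"
  proof unfold_locales
    show "E (P0 n x) = P0 n (E x)" for n x
      by (simp add: P0_def block_diagonal_part_apply blinfun.bilinear_simps E_idem)
    show "norm (N n) \<le> \<bar>M\<bar>" if "n \<in> J" for n
      using M[OF that] norm_block_op_upper_le[of "A12 n"] by (simp add: N_def)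
    show "E (N n x) = N n x" "N n (E x) = 0" for n x
      by (cases x; simp add: E_def N_def zero_prod_def)+
  qed (simp_all add: E_A)
  obtain P' G' K' where data': "dichotomy_data J (\<lambda>n. A n + N n) P' G' K' (\<alpha> / 2)"
    and P': "\<forall>U. intertwines U U D \<and> intertwines U U Q \<and> intertwines U U R \<longrightarrow> intertwines U U P'"
    by (rule dichotomy_data_perturbed) (rule that, assumption+)
  have "P' n \<in> bounded_ops scale scale" for n
    unfolding ops_iff
  proof (intro allI)
    fix c x
    \<comment> \<open>Linearity of \<open>P' n\<close> over the scalar field is commutation with
      this real bounded operator for every \<open>c\<close>, and it is inherited from
      \<open>D\<close>, \<open>Q\<close> and \<open>R\<close>.\<close>
    define U where "U = Blinfun (scale c)"
    have "bounded_linear (scale c)"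
      unfolding scale_def
      by (intro bounded_linear_Pair bounded_linear_compose[OF S1.bounded_linear_scaling bounded_linear_fst]
          bounded_linear_compose[OF S2.bounded_linear_scaling bounded_linear_snd])
    then have U: "U x = scale c x" for x
      by (simp add: U_def bounded_linear_Blinfun_apply)
    have "A n (scale c x) = scale c (A n x)" "N n (scale c x) = scale c (N n x)" if "n \<in> J" for n x
      using that by (cases x; simp add: A_def N_def scale_def A11 A12 A22)+
    then have DR: "intertwines U U D" "intertwines U U R"
      by (auto simp: intertwines_def U D_def R_def step_def)
    have "P n (scale c x) = scale c (P n x)" if "n \<in> J" for n x
      using P[OF that] ops_iff by blast
    moreover have "E (scale c x) = scale c (E x)" for x
      by (cases x) (simp add: E_def scale_def)
    ultimately have "intertwines U U Q"
      by (auto simp: intertwines_def U Q_def P0_def block_diagonal_part_apply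
          blinfun.diff_right p.scale_right_distrib p.scale_right_diff_distrib)
    then show "P' n (scale c x) = scale c (P' n x)"
      using P' DR intertwinesD[of U U P' n x] by (simp add: U)
  qed
  then have "exponential_dichotomy scale J (\<lambda>n. A n + N n)"
    by (intro dichotomy_data.imp_exponential_dichotomy[OF data' assms(3)])
  also have "(\<lambda>n. A n + N n) = (\<lambda>n. block_op (A11 n) (A12 n) 0 (A22 n))"
    by (intro ext blinfun_eqI) (auto simp: A_def N_def blinfun.add_left)
  finally show ?thesis .
qed

end
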